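(* For every integer $n\ge 3$, $$\tau_5(C_n)=\begin{cases}20 & \text{if } n=5,\\ 18 & \text{if } n\in\{4,6\},\\ 17 & \text{if } n\in\{7,9\},\\ 15 & \text{if } n=3,\\ 16 & \text{otherwise.}\end{cases}$$
   Context: $C_n$ is the cycle on $n$ vertices. $[k]=\{1,\dots,k\}$ and $\binom{[k]}{t}$ is the collection of all $t$-element subsets of $[k]$. $d(v,w)$ is the distance between $v$ and $w$. For a finite simple graph $G$ and positive integers $t,k$, a $t$-tone $k$-coloring of $G$ is a function $f:V(G)\to\binom{[k]}{t}$ such that $|f(v)\cap f(w)|<d(v,w)$ for all distinct $v,w\in V(G)$. The $t$-tone chromatic number $\tau_t(G)$ is the minimum $k$ such that $G$ has a $t$-tone $k$-coloring. *)

theory Defs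
  imports "Graph_Theory.Graph_Theory"
begin

definition cycle_graph :: "nat \<Rightarrow> nat pair_pre_digraph" where
  "cycle_graph n =
     \<lparr> pverts = {0..<n},
       parcs = {(i, Suc i mod n) | i. i < n} \<union> {(Suc i mod n, i) | i. i < n} \<rparr>"

text \<open>The minimum number of arcs on a walk from \<open>u\<close> to \<open>v\<close> (\<open>\<infinity>\<close> if there is none).\<close>

definition graph_dist :: "('a, 'b) pre_digraph \<Rightarrow> 'a \<Rightarrow> 'a \<Rightarrow> ereal" where
  "graph_dist G u v = wf_digraph.\<mu> G (\<lambda>_. 1) u v"

text \<open>Only the values of \<open>f\<close> on \<open>verts G\<close> are constrained.\<close>

definition tone_coloring ::
  "nat \<Rightarrow> nat \<Rightarrow> ('a, 'b) pre_digraph \<Rightarrow> ('a \<Rightarrow> nat set) \<Rightarrow> bool" where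
  "tone_coloring t k G f \<longleftrightarrow>
     (\<forall>v\<in>verts G. f v \<subseteq> {1..k} \<and> card (f v) = t) \<and>
     (\<forall>v\<in>verts G. \<forall>w\<in>verts G. v \<noteq> w \<longrightarrow>
        ereal (real (card (f v \<inter> f w))) < graph_dist G v w)"

definition tone_chromatic_number :: "nat \<Rightarrow> ('a, 'b) pre_digraph \<Rightarrow> nat" where
  "tone_chromatic_number t G = (LEAST k. 0 < k \<and> (\<exists>f. tone_coloring t k G f))"

lemma graph_cycle_graph:
  assumes "n \<ge> 3"
  shows "graph (with_proj (cycle_graph n))"
proof -
  have nl: "Suc i mod n \<noteq> i" if "i < n" for i
    using that assms by (cases "Suc i = n") auto
  have "pair_graph (cycle_graph n)"
  proof
    show "finite (pverts (cycle_graph n))" by (simp add: cycle_graph_def)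
    have "parcs (cycle_graph n) \<subseteq> {0..<n} \<times> {0..<n}"
      using assms by (auto simp: cycle_graph_def)
    then show "finite (parcs (cycle_graph n))"
      by (rule finite_subset) simp
  next
    fix e assume "e \<in> parcs (cycle_graph n)"
    then show "fst e \<in> pverts (cycle_graph n)" "snd e \<in> pverts (cycle_graph n)"
        "fst e \<noteq> snd e"
      using assms nl by (auto simp: cycle_graph_def dest: sym)
  next
    show "symmetric (with_proj (cycle_graph n))"
      by (auto simp: symmetric_def sym_def cycle_graph_def)
  qed
  then show ?thesis by (rule pair_graph.pair_graphD_graph)
qed

lemma graph_dist_eq_INF_length:
  assumes "wf_digraph G"
  shows "graph_dist G u v =
    (INF p \<in> {p. pre_digraph.awalk G u p v}. ereal (real (length p)))"
proof -
  interpret wf_digraph G by fact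
  have "awalk_cost (\<lambda>_. 1) p = real (length p)" for p :: "'b list"
    by (simp add: awalk_cost_def sum_list_triv)
  then show ?thesis by (simp add: graph_dist_def \<mu>_def)
qed

text \<open>Some coloring exists, so the \<open>LEAST\<close> above is attained.\<close>

lemma ex_tone_coloring:
  assumes "wf_digraph G" "finite (verts G)"
  shows "\<exists>k>0. \<exists>f. tone_coloring t k G f"
proof -
  interpret wf_digraph G by fact
  obtain g :: "'a \<Rightarrow> nat" where g: "inj_on g (verts G)" "g ` verts G = {0..<card (verts G)}"
    using ex_bij_betw_finite_nat[OF assms(2)] unfolding bij_betw_def by blast
  define f where "f v = {g v * t + 1 .. g v * t + t}" for v
  define k where "k = card (verts G) * t + 1"
  have sub: "f v \<subseteq> {1..k}" if "v \<in> verts G" for v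
  proof -
    have "g v \<in> {0..<card (verts G)}" using that g(2) by blast
    then have "Suc (g v) \<le> card (verts G)" by simp
    then have "Suc (g v) * t \<le> card (verts G) * t" by (rule mult_le_mono1)
    then show ?thesis unfolding f_def k_def by auto
  qed
  have aux: "f v \<inter> f w = {}" if "g v < g w" for v w
  proof -
    have "Suc (g v) * t \<le> g w * t" using that by (intro mult_le_mono1) simp
    then show ?thesis unfolding f_def by auto
  qed
  have disj: "f v \<inter> f w = {}" if "v \<in> verts G" "w \<in> verts G" "v \<noteq> w" for v w
  proof -
    have "g v \<noteq> g w" using g(1) that by (auto dest: inj_onD)
    then show ?thesis using aux[of v w] aux[of w v] by (auto simp: neq_iff)
  qed
  have pos: "0 < graph_dist G v w" if "v \<noteq> w" for v w
  proof -
    have "1 \<le> graph_dist G v w"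
      unfolding graph_dist_eq_INF_length[OF assms(1)]
    proof (rule INF_greatest)
      fix p assume "p \<in> {p. awalk v p w}"
      then have "p \<noteq> []" using that by (auto simp: awalk_Nil_iff)
      then show "1 \<le> ereal (real (length p))" by (cases p) auto
    qed
    then show ?thesis by (rule less_le_trans[rotated]) simp
  qed
  have "tone_coloring t k G f"
    unfolding tone_coloring_def using sub disj pos by (auto simp: f_def zero_ereal_def[symmetric])
  then show ?thesis unfolding k_def by auto
qed

end

theory Submission
  imports Defs
begin

text \<open>
  Distances in \<open>C\<^sub>n\<close> are cyclic differences: an assignment \<open>f\<close> of 5-element labels is a coloring
  iff \<open>card (f i \<inter> f ((i + d) mod n)) < d\<close> whenever \<open>0 < d\<close> and \<open>2 * d \<le> n\<close>.

  \<^bold>\<open>Lower bounds.\<close> For \<open>n \<ge> 4\<close>, four consecutive labels have pairwise intersections of total size at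
  most \<open>1 + 1 + 2\<close>, so their union needs \<open>4 * 5 - 4 = 16\<close> colors (\<open>four_consecutive_labels\<close>). For
  \<open>n \<in> {3, 4, 5, 6, 7, 9}\<close> the sharp bound comes from linear programming (\<open>weighted_color_count\<close>). The
  vertices whose label contains a given color form an independent set of \<open>C\<^sub>n\<close>; write \<open>s\<close> for its
  size and \<open>p\<^sub>d\<close> for the number of \<open>i\<close> such that \<open>i\<close> and \<open>i + d\<close> (modulo \<open>n\<close>) both belong to it. Suitable
  weights give an inequality \<open>a * s \<le> c + y\<^sub>2 * p\<^sub>2 + y\<^sub>3 * p\<^sub>3\<close> for every independent set. Summing it
  over the \<open>k\<close> colors, where the \<open>s\<close> add up to \<open>5 * n\<close> and the \<open>p\<^sub>d\<close> to at most \<open>n * (d - 1)\<close>, yields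
  a lower bound on \<open>k\<close>.

  \<^bold>\<open>Upper bounds.\<close> The six exceptional lengths have explicit colorings. For the other lengths,
  consider \<^emph>\<open>blocks\<close>: words of labels over 16 colors which begin with one fixed word of five labels
  and satisfy the distance conditions when this word is appended again. Distances above 5 impose no
  condition, so only windows of six consecutive labels matter, and hence the concatenation of
  two blocks is a block (\<open>is_block_append\<close>) and a block of length \<open>n\<close> closes up to a coloring of
  \<open>C\<^sub>n\<close>. There are blocks of the lengths 8, 10, 11, 12, 13, 14, 15 and 17, and every \<open>n \<ge> 8\<close>
  other than 9 arises from one of these by adding a multiple of 8.
\<close>

section \<open>Distances and tone colorings on a cycle\<close>

lemma cycle_awalk_shift:
  assumes "n \<ge> 3" "i < n"
  shows "\<exists>p. pre_digraph.awalk (with_proj (cycle_graph n)) i p ((i + d) mod n) \<and> length p = d"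
proof -
  interpret graph "with_proj (cycle_graph n)" by (rule graph_cycle_graph[OF assms(1)])
  show ?thesis
  proof (induction d)
    case 0
    have "awalk i [] i" using assms unfolding awalk_Nil_iff by (simp add: cycle_graph_def)
    then show ?case using assms by auto
  next
    case (Suc d)
    let ?j = "(i + d) mod n"
    obtain p where p: "awalk i p ?j" "length p = d" using Suc by blast
    have "(?j, Suc ?j mod n) \<in> parcs (cycle_graph n)"
      using assms by (auto simp: cycle_graph_def)
    moreover have "Suc ?j mod n < n" using assms by simp
    ultimately have "awalk ?j [(?j, Suc ?j mod n)] (Suc ?j mod n)"
      unfolding awalk_Cons_iff awalk_Nil_iff by (auto simp: cycle_graph_def)
    from awalk_appendI[OF p(1) this] p(2) show ?case
      by (intro exI[of _ "p @ [(?j, Suc ?j mod n)]"]) (simp add: mod_Suc_eq)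
  qed
qed

lemma graph_dist_cycle_le:
  assumes "n \<ge> 3" "i < n"
  shows "graph_dist (with_proj (cycle_graph n)) i ((i + d) mod n) \<le> ereal (real d)"
proof -
  interpret graph "with_proj (cycle_graph n)" by (rule graph_cycle_graph[OF assms(1)])
  obtain p where "awalk i p ((i + d) mod n)" "length p = d"
    using cycle_awalk_shift[OF assms] by blast
  then show ?thesis
    unfolding graph_dist_eq_INF_length[OF wf_digraph_axioms] by (auto intro!: INF_lower2[of p])
qed

lemma cycle_awalk_length_ge:
  assumes "n \<ge> 3" "pre_digraph.awalk (with_proj (cycle_graph n)) u p v"
  shows "min \<bar>int u - int v\<bar> (int n - \<bar>int u - int v\<bar>) \<le> int (length p)"
proof -
  interpret graph "with_proj (cycle_graph n)" by (rule graph_cycle_graph[OF assms(1)])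
  show ?thesis
    using assms(2)
  proof (induction p arbitrary: u)
    case Nil
    then show ?case by (simp add: awalk_Nil_iff)
  next
    case (Cons e p)
    then obtain w where e: "(u, w) \<in> parcs (cycle_graph n)" and w: "awalk w p v"
      by (cases e) (auto simp: awalk_Cons_iff)
    have IH: "min \<bar>int w - int v\<bar> (int n - \<bar>int w - int v\<bar>) \<le> int (length p)"
      by (rule Cons.IH[OF w])
    have "v < n" using awalk_last_in_verts[OF w] by (simp add: cycle_graph_def)
    have "u < n \<and> w = Suc u mod n \<or> w < n \<and> u = Suc w mod n"
      using e by (auto simp: cycle_graph_def)
    then have "u < n \<and> w = (if Suc u = n then 0 else Suc u) \<or>
        w < n \<and> u = (if Suc w = n then 0 else Suc w)"
      using assms(1) by (auto simp: mod_Suc)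
    then show ?case using IH \<open>v < n\<close> by (auto split: if_splits)
  qed
qed

lemma graph_dist_cycle_ge:
  assumes "n \<ge> 3" "u < v" "v < n"
  shows "ereal (real (min (v - u) (n - (v - u)))) \<le> graph_dist (with_proj (cycle_graph n)) u v"
    and "ereal (real (min (v - u) (n - (v - u)))) \<le> graph_dist (with_proj (cycle_graph n)) v u"
proof -
  interpret graph "with_proj (cycle_graph n)" by (rule graph_cycle_graph[OF assms(1)])
  have "min (v - u) (n - (v - u)) \<le> length p" if "awalk u p v \<or> awalk v p u" for p
    using that cycle_awalk_length_ge[OF assms(1), of u p v] assms
      cycle_awalk_length_ge[OF assms(1), of v p u] by (auto simp: min_def split: if_splits)
  then show "ereal (real (min (v - u) (n - (v - u)))) \<le> graph_dist (with_proj (cycle_graph n)) u v"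
    "ereal (real (min (v - u) (n - (v - u)))) \<le> graph_dist (with_proj (cycle_graph n)) v u"
    unfolding graph_dist_eq_INF_length[OF wf_digraph_axioms]
    by (auto intro!: INF_greatest simp del: of_nat_min)
qed

lemma tone_coloring_cycleI:
  assumes n: "n \<ge> 3"
    and labels: "\<And>i. i < n \<Longrightarrow> f i \<subseteq> {1..k} \<and> card (f i) = t"
    and common: "\<And>i d. i < n \<Longrightarrow> 0 < d \<Longrightarrow> 2 * d \<le> n \<Longrightarrow> card (f i \<inter> f ((i + d) mod n)) < d"
  shows "tone_coloring t k (with_proj (cycle_graph n)) f"
proof -
  have *: "card (f u \<inter> f v) < min (v - u) (n - (v - u))" if "u < v" "v < n" for u v
  proof (cases "2 * (v - u) \<le> n")
    case True
    then show ?thesis using common[of u "v - u"] that by simp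
  next
    case False
    have "v + (n - (v - u)) = u + n" using that by simp
    then have "(v + (n - (v - u))) mod n = u" using that by simp
    then show ?thesis using common[of v "n - (v - u)"] that False by (simp add: Int_commute)
  qed
  have "ereal (real (card (f v \<inter> f w))) < graph_dist (with_proj (cycle_graph n)) v w"
    if vw: "v < n" "w < n" "v \<noteq> w" for v w
  proof (cases "v < w")
    case True
    have "ereal (real (card (f v \<inter> f w))) < ereal (real (min (w - v) (n - (w - v))))"
      using *[OF True vw(2)] by (simp only: ereal_less_eq less_ereal.simps of_nat_less_iff)
    with graph_dist_cycle_ge(1)[OF n True vw(2)] show ?thesis by (rule less_le_trans[rotated])
  next
    case False
    then have wv: "w < v" using vw by simp
    have "ereal (real (card (f v \<inter> f w))) < ereal (real (min (v - w) (n - (v - w))))"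
      using *[OF wv vw(1)] by (simp only: Int_commute less_ereal.simps of_nat_less_iff)
    with graph_dist_cycle_ge(2)[OF n wv vw(1)] show ?thesis by (rule less_le_trans[rotated])
  qed
  then show ?thesis using labels by (auto simp: tone_coloring_def cycle_graph_def)
qed

lemma tone_coloring_cycleD:
  assumes "tone_coloring t k (with_proj (cycle_graph n)) f" "n \<ge> 3" "i < n"
  shows "f i \<subseteq> {1..k}" "card (f i) = t"
    and "\<And>d. 0 < d \<Longrightarrow> d < n \<Longrightarrow> card (f i \<inter> f ((i + d) mod n)) < d"
proof -
  show "f i \<subseteq> {1..k}" "card (f i) = t"
    using assms by (auto simp: tone_coloring_def cycle_graph_def)
  fix d assume d: "0 < d" "d < n"
  have "(i + d) mod n = (if i + d < n then i + d else i + d - n)"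
    using assms d by (auto simp: mod_if)
  then have "i \<noteq> (i + d) mod n" using d assms by auto
  moreover have "(i + d) mod n < n" using d by simp
  ultimately have "ereal (real (card (f i \<inter> f ((i + d) mod n))))
      < graph_dist (with_proj (cycle_graph n)) i ((i + d) mod n)"
    using assms by (auto simp: tone_coloring_def cycle_graph_def)
  also have "\<dots> \<le> ereal (real d)" by (rule graph_dist_cycle_le[OF assms(2,3)])
  finally show "card (f i \<inter> f ((i + d) mod n)) < d" by simp
qed

section \<open>Lower bounds\<close>

lemma four_consecutive_labels:
  assumes col: "tone_coloring t k (with_proj (cycle_graph n)) f" and n: "n \<ge> 4"
  shows "4 * t \<le> k + 4"
proof -
  note D = tone_coloring_cycleD[OF col]
  let ?A = "f 0" and ?B = "f 1" and ?C = "f 2" and ?D = "f 3"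
  have sub: "f i \<subseteq> {1..k}" "card (f i) = t" if "i < 4" for i
    using D[of i] n that by auto
  have fin: "finite (f i)" if "i < 4" for i
    using sub(1)[OF that] by (rule finite_subset) simp
  have common: "card (f i \<inter> f (i + d)) < d" if "0 < d" "i + d < 4" for i d
    using D(3)[of i d] n that by simp
  have BA: "?B \<inter> ?A = {}" and CB: "?C \<inter> ?B = {}" and DC: "?D \<inter> ?C = {}"
    using common[of 1 0] common[of 1 1] common[of 1 2] fin
    by (auto simp: numeral_2_eq_2 numeral_3_eq_3)
  have CA: "card (?C \<inter> ?A) \<le> 1" and DB: "card (?D \<inter> ?B) \<le> 1" and DA: "card (?D \<inter> ?A) \<le> 2"
    using common[of 2 0] common[of 2 1] common[of 3 0]
    by (auto simp: Int_commute numeral_3_eq_3 numeral_2_eq_2)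
  have "card (?A \<union> ?B) = t + t"
    using card_Un_Int[of ?A ?B] BA sub(2)[of 0] sub(2)[of 1] fin[of 0] fin[of 1]
    by (simp add: Int_commute)
  moreover have "card (?A \<union> ?B) + t = card (?A \<union> ?B \<union> ?C) + card (?C \<inter> ?A)"
  proof -
    have "(?A \<union> ?B) \<inter> ?C = ?C \<inter> ?A" using CB by blast
    then show ?thesis
      using card_Un_Int[of "?A \<union> ?B" ?C] sub(2)[of 2] fin[of 0] fin[of 1] fin[of 2] by simp
  qed
  moreover have "card (?A \<union> ?B \<union> ?C) + t \<le> card (?A \<union> ?B \<union> ?C \<union> ?D) + 3"
  proof -
    have "(?A \<union> ?B \<union> ?C) \<inter> ?D = (?D \<inter> ?A) \<union> (?D \<inter> ?B)" using DC by blast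
    then have "card ((?A \<union> ?B \<union> ?C) \<inter> ?D) \<le> 3"
      using card_Un_le[of "?D \<inter> ?A" "?D \<inter> ?B"] DA DB by simp
    then show ?thesis
      using card_Un_Int[of "?A \<union> ?B \<union> ?C" ?D] sub(2)[of 3] fin[of 0] fin[of 1] fin[of 2] fin[of 3]
      by simp
  qed
  moreover have "card (?A \<union> ?B \<union> ?C \<union> ?D) \<le> k"
    using card_mono[of "{1..k}" "?A \<union> ?B \<union> ?C \<union> ?D"] sub(1)[of 0] sub(1)[of 1] sub(1)[of 2] sub(1)[of 3]
    by simp
  ultimately show ?thesis using CA by simp
qed

lemma sum_colors_of_bool:
  fixes k :: nat
  assumes "A \<subseteq> {1..k}"
  shows "(\<Sum>c\<in>{1..k}. of_bool (c \<in> A)) = card A"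
proof -
  have "{1..k} \<inter> A = A" using assms by blast
  then show ?thesis by (simp add: of_bool_def sum.If_cases Int_def)
qed

text \<open>
  Feasibility of weights for the linear program: the lists \<open>b\<close> with no two cyclically adjacent
  entries \<open>True\<close> are the independent sets of the cycle, \<open>a\<close> is the weight of a vertex, \<open>c\<close> that of a
  color and \<open>y d\<close> that of a pair at cyclic difference \<open>d\<close>. Quantifying over an explicit list makes
  the notion executable. Pairs are counted by their first vertex, so that opposite vertices
  (\<open>2 * d = n\<close>) count twice.
\<close>

definition dual_feasible :: "nat \<Rightarrow> nat \<Rightarrow> nat \<Rightarrow> nat set \<Rightarrow> (nat \<Rightarrow> nat) \<Rightarrow> bool" where
  "dual_feasible n a c D y \<longleftrightarrow>
     (\<forall>b\<in>set (List.n_lists n [False, True]).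
        (\<forall>i\<in>{..<n}. \<not> (b ! i \<and> b ! ((i + 1) mod n))) \<longrightarrow>
        a * (\<Sum>i<n. of_bool (b ! i)) \<le>
          c + (\<Sum>d\<in>D. y d * (\<Sum>i<n. of_bool (b ! i \<and> b ! ((i + d) mod n)))))"

text \<open>Weak duality: the inequality for each color is summed over all colors.\<close>

lemma weighted_color_count:
  assumes col: "tone_coloring t k (with_proj (cycle_graph n)) f" and n: "n \<ge> 3"
    and D: "D \<subseteq> {0<..<n}" and feas: "dual_feasible n a c D y"
  shows "a * (n * t) \<le> c * k + (\<Sum>d\<in>D. y d * (n * (d - 1)))"
proof -
  note lab = tone_coloring_cycleD[OF col n]
  have color: "a * (\<Sum>i<n. of_bool (x \<in> f i)) \<le>
      c + (\<Sum>d\<in>D. y d * (\<Sum>i<n. of_bool (x \<in> f i \<and> x \<in> f ((i + d) mod n))))" for x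
  proof -
    let ?b = "map (\<lambda>i. x \<in> f i) [0..<n]"
    have nth: "?b ! (i mod n) \<longleftrightarrow> x \<in> f (i mod n)" for i using n by simp
    have nth': "?b ! i \<longleftrightarrow> x \<in> f i" if "i < n" for i using that by simp
    have "?b \<in> set (List.n_lists n [False, True])" by (auto simp: set_n_lists)
    moreover have "\<not> (?b ! i \<and> ?b ! ((i + 1) mod n))" if "i < n" for i
    proof -
      have "finite (f i)" using lab(1)[OF that] by (rule finite_subset) simp
      then have "f i \<inter> f ((i + 1) mod n) = {}" using lab(3)[OF that, of 1] n by auto
      then show ?thesis unfolding nth nth'[OF that] by blast
    qed
    ultimately have "a * (\<Sum>i<n. of_bool (?b ! i)) \<le>
        c + (\<Sum>d\<in>D. y d * (\<Sum>i<n. of_bool (?b ! i \<and> ?b ! ((i + d) mod n))))"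
      using feas unfolding dual_feasible_def by blast
    then show ?thesis unfolding nth by (simp add: nth' del: nth_map)
  qed
  have "a * (n * t) = a * (\<Sum>i<n. \<Sum>x\<in>{1..k}. of_bool (x \<in> f i))"
  proof -
    have "(\<Sum>x\<in>{1..k}. of_bool (x \<in> f i)) = t" if "i < n" for i
      using sum_colors_of_bool[OF lab(1)[OF that]] lab(2)[OF that] by simp
    then show ?thesis by simp
  qed
  also have "\<dots> = (\<Sum>x\<in>{1..k}. a * (\<Sum>i<n. of_bool (x \<in> f i)))"
    by (subst sum.swap) (simp add: sum_distrib_left)
  also have "\<dots> \<le> (\<Sum>x\<in>{1..k}. c + (\<Sum>d\<in>D. y d * (\<Sum>i<n. of_bool (x \<in> f i \<and> x \<in> f ((i + d) mod n)))))"
    by (rule sum_mono) (rule color)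
  also have "\<dots> = c * k + (\<Sum>d\<in>D. y d * (\<Sum>i<n. \<Sum>x\<in>{1..k}. of_bool (x \<in> f i \<inter> f ((i + d) mod n))))"
    unfolding sum.distrib sum.swap[of _ D] sum_distrib_left[symmetric] sum.swap[of _ "{..<n}"]
    by simp
  also have "\<dots> \<le> c * k + (\<Sum>d\<in>D. y d * (n * (d - 1)))"
  proof -
    have "(\<Sum>i<n. \<Sum>x\<in>{1..k}. of_bool (x \<in> f i \<inter> f ((i + d) mod n))) \<le> n * (d - 1)"
      if "d \<in> D" for d
    proof -
      have "(\<Sum>x\<in>{1..k}. of_bool (x \<in> f i \<inter> f ((i + d) mod n))) \<le> d - 1" if "i < n" for i
      proof -
        have "f i \<inter> f ((i + d) mod n) \<subseteq> {1..k}" using lab(1)[OF that] by blast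
        moreover have "card (f i \<inter> f ((i + d) mod n)) < d"
          using lab(3)[OF that] \<open>d \<in> D\<close> D by auto
        ultimately show ?thesis by (subst sum_colors_of_bool) auto
      qed
      then show ?thesis using sum_bounded_above[of "{..<n}" _ "d - 1"] by fastforce
    qed
    then show ?thesis by (intro add_left_mono sum_mono mult_left_mono) auto
  qed
  finally show ?thesis .
qed

text \<open>
  The weights below are dual solutions scaled to integers. For the cycles of length 7 and 9 the
  resulting bound on \<open>k\<close> is fractional and lies between 16 and 17.
\<close>

lemma tone_coloring_cycle_3_ge:
  assumes "tone_coloring 5 k (with_proj (cycle_graph 3)) f"
  shows "15 \<le> k"
proof -
  have "dual_feasible 3 1 1 {} (\<lambda>_. 0)" by code_simp
  from weighted_color_count[OF assms _ _ this] show ?thesis by simp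
qed

lemma tone_coloring_cycle_4_ge:
  assumes "tone_coloring 5 k (with_proj (cycle_graph 4)) f"
  shows "18 \<le> k"
proof -
  have "dual_feasible 4 2 2 {2} (\<lambda>_. 1)" by code_simp
  from weighted_color_count[OF assms _ _ this] show ?thesis by simp
qed

lemma tone_coloring_cycle_5_ge:
  assumes "tone_coloring 5 k (with_proj (cycle_graph 5)) f"
  shows "20 \<le> k"
proof -
  have "dual_feasible 5 1 1 {2} (\<lambda>_. 1)" by code_simp
  from weighted_color_count[OF assms _ _ this] show ?thesis by simp
qed

lemma tone_coloring_cycle_6_ge:
  assumes "tone_coloring 5 k (with_proj (cycle_graph 6)) f"
  shows "18 \<le> k"
proof -
  have "dual_feasible 6 2 2 {2, 3} (\<lambda>d. 4 - d)" by code_simp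
  from weighted_color_count[OF assms _ _ this] show ?thesis by simp
qed

lemma tone_coloring_cycle_7_ge:
  assumes "tone_coloring 5 k (with_proj (cycle_graph 7)) f"
  shows "17 \<le> k"
proof -
  have "dual_feasible 7 2 3 {2, 3} (\<lambda>_. 1)" by code_simp
  from weighted_color_count[OF assms _ _ this] show ?thesis by simp
qed

lemma tone_coloring_cycle_9_ge:
  assumes "tone_coloring 5 k (with_proj (cycle_graph 9)) f"
  shows "17 \<le> k"
proof -
  have "dual_feasible 9 3 6 {2, 3} (\<lambda>d. 4 - d)" by code_simp
  from weighted_color_count[OF assms _ _ this] show ?thesis by simp
qed

section \<open>Words of labels\<close>

text \<open>
  A word of labels, each given as a list of \<open>t\<close> distinct colors in \<open>{1..k}\<close>, in which two entries
  at index difference \<open>d \<le> m\<close> have fewer than \<open>d\<close> common colors. The bounded quantifiers over lists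
  make the notion executable.
\<close>

definition tone_word :: "nat \<Rightarrow> nat \<Rightarrow> nat \<Rightarrow> nat list list \<Rightarrow> bool" where
  "tone_word t k m xs \<longleftrightarrow>
     (\<forall>x\<in>set xs. distinct x \<and> length x = t \<and> (\<forall>c\<in>set x. 1 \<le> c \<and> c \<le> k)) \<and>
     (\<forall>i\<in>set [0..<length xs]. \<forall>d\<in>set [1..<Suc m]. i + d < length xs \<longrightarrow>
        length (filter (\<lambda>c. c \<in> set (xs ! (i + d))) (xs ! i)) < d)"

lemma tone_word_common:
  assumes "tone_word t k m xs" "0 < d" "d \<le> m" "i + d < length xs"
  shows "length (filter (\<lambda>c. c \<in> set (xs ! (i + d))) (xs ! i)) < d"
proof -
  have "i \<in> set [0..<length xs]" "d \<in> set [1..<Suc m]" using assms(2-4) by auto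
  then show ?thesis using assms(1,4) unfolding tone_word_def by blast
qed

text \<open>
  Appending \<open>take m ws\<close> turns differences around the cycle into differences along a word. Differences
  \<open>d > m\<close> need no check: either \<open>d > t\<close>, or \<open>2 * d > n\<close> and the other way round is shorter.
\<close>

lemma tone_coloring_closed_word:
  assumes word: "tone_word t k m (ws @ take m ws)"
    and n: "length ws = n" "n \<ge> 3" and m: "m \<le> n" "t \<le> m \<or> n div 2 \<le> m"
  shows "tone_coloring t k (with_proj (cycle_graph n)) (\<lambda>i. set (ws ! i))"
proof (rule tone_coloring_cycleI[OF n(2)])
  fix i assume i: "i < n"
  then have "ws ! i \<in> set (ws @ take m ws)" using n by simp
  then have x: "distinct (ws ! i)" "length (ws ! i) = t" "set (ws ! i) \<subseteq> {1..k}"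
    using word by (auto simp: tone_word_def simp del: set_append)
  then show "set (ws ! i) \<subseteq> {1..k} \<and> card (set (ws ! i)) = t"
    by (simp add: distinct_card)
  fix d assume d: "0 < d" "2 * d \<le> n"
  show "card (set (ws ! i) \<inter> set (ws ! ((i + d) mod n))) < d"
  proof (cases "d \<le> m")
    case True
    have nth: "(ws @ take m ws) ! (i + d) = ws ! ((i + d) mod n)"
      using i d n True by (auto simp: nth_append mod_if)
    have "length (filter (\<lambda>c. c \<in> set (ws ! ((i + d) mod n))) (ws ! i)) < d"
      using tone_word_common[OF word d(1) True, of i] i n m True
      by (simp add: nth) (simp add: nth_append)
    moreover have "set (ws ! i) \<inter> set (ws ! ((i + d) mod n))
        = set (filter (\<lambda>c. c \<in> set (ws ! ((i + d) mod n))) (ws ! i))" by auto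
    ultimately show ?thesis by (metis card_length le_less_trans)
  next
    case False
    then have "t < d" using m d by auto
    moreover have "card (set (ws ! i) \<inter> set (ws ! ((i + d) mod n))) \<le> card (set (ws ! i))"
      by (rule card_mono) auto
    ultimately show ?thesis using x by (simp add: distinct_card)
  qed
qed

text \<open>A violation of the conditions is visible in a window of \<open>m + 1\<close> letters, and each such window
  of the long word lies in one of the two short ones.\<close>

lemma tone_word_overlap:
  assumes us: "tone_word t k m (us @ p)" and ws: "tone_word t k m (ws @ p)"
    and p: "take m ws = p" "length p = m"
  shows "tone_word t k m (us @ ws @ p)"
proof -
  have "length (filter (\<lambda>c. c \<in> set ((us @ ws @ p) ! (i + d))) ((us @ ws @ p) ! i)) < d"
    if d: "0 < d" "d \<le> m" "i + d < length (us @ ws @ p)" for i d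
  proof (cases "i < length us")
    case True
    have "(us @ ws @ p) ! (i + d) = (us @ p) ! (i + d)"
    proof (cases "i + d < length us")
      case False
      then have "i + d - length us < m" using True d by simp
      moreover have "m \<le> length ws" using p by auto
      ultimately show ?thesis using False p(1) by (auto simp: nth_append)
    qed (simp add: nth_append)
    then show ?thesis
      using tone_word_common[OF us d(1,2), of i] True d p(2) by (simp add: nth_append)
  next
    case False
    then show ?thesis
      using tone_word_common[OF ws d(1,2), of "i - length us"] d by (simp add: nth_append)
  qed
  then show ?thesis using us ws by (auto simp: tone_word_def)
qed

section \<open>Colorings with 16 colors\<close>

definition block_start :: "nat list list" where
  "block_start =
   [[1,2,3,4,5], [6,7,8,9,10], [1,11,12,13,14], [2,3,6,15,16],
    [4,5,7,8,11]]"

text \<open>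
  A block of length \<open>n\<close> respects the distance conditions when \<open>block_start\<close> follows it. Every block
  starts in this way, so any block may follow any other, and a block may be closed up to a cycle.
\<close>

definition is_block :: "nat \<Rightarrow> nat list list \<Rightarrow> bool" where
  "is_block n ws \<longleftrightarrow>
     length ws = n \<and> take 5 ws = block_start \<and> tone_word 5 16 5 (ws @ block_start)"

lemma is_block_append:
  assumes "is_block m us" "is_block n ws"
  shows "is_block (m + n) (us @ ws)"
proof -
  have len: "length block_start = 5" by (simp add: block_start_def)
  then have "length (take 5 us) = 5" using assms by (simp add: is_block_def)
  then have "take 5 (us @ ws) = take 5 us" by auto
  then show ?thesis
    using assms tone_word_overlap[of 5 16 5 us block_start ws] len by (simp add: is_block_def)
qed

text \<open>
  Equality in the bound for four consecutive labels forces a rigid pattern on 16 colors: of the five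
  colors at each position, one recurs after 2 steps, two after 3 steps and two after 4 steps. A block
  of length \<open>n\<close> is therefore a system of 16 closed sequences of such steps, each of total length \<open>n\<close>.
\<close>

lemma block_8:
  "is_block 8 (block_start @
    [[1,2,9,10,14], [3,6,8,12,13], [7,11,14,15,16]])"
  by code_simp

lemma block_10:
  "is_block 10 (block_start @
    [[9,10,12,14,15], [1,2,4,6,13], [3,5,8,10,16], [1,7,9,11,14],
     [6,12,13,15,16]])"
  by code_simp

lemma block_11:
  "is_block 11 (block_start @
    [[1,9,10,14,16], [2,6,11,12,13], [3,5,8,15,16], [2,4,7,9,14],
     [1,8,10,12,13], [6,11,14,15,16]])"
  by code_simp

lemma block_12:
  "is_block 12 (block_start @
    [[1,2,9,10,14], [3,5,6,12,13], [7,8,9,15,16], [2,3,4,11,14],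
     [1,5,6,7,10], [2,8,9,12,13], [10,11,14,15,16]])"
  by code_simp

lemma block_13:
  "is_block 13 (block_start @
    [[1,9,10,12,15], [2,3,5,13,14], [6,8,10,11,16], [4,7,9,13,15],
     [1,2,5,12,16], [3,4,6,10,14], [1,8,9,11,13], [7,12,14,15,16]])"
  by code_simp

lemma block_14:
  "is_block 14 (block_start @
    [[1,2,9,10,14], [6,11,12,13,15], [3,4,5,14,16], [1,2,7,8,12],
     [9,10,13,15,16], [1,3,6,11,14], [4,5,7,8,13], [2,9,10,11,12],
     [6,13,14,15,16]])"
  by code_simp

lemma block_15:
  "is_block 15 (block_start @
    [[1,6,9,10,14], [3,11,12,13,16], [2,4,7,9,15], [1,5,8,10,16],
     [6,9,11,13,14], [3,7,10,12,15], [2,4,5,13,16], [1,3,8,9,14],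
     [4,6,10,11,12], [7,13,14,15,16]])"
  by code_simp

lemma block_17:
  "is_block 17 (block_start @
    [[1,2,9,10,14], [5,6,12,13,16], [2,3,7,8,15], [1,4,11,12,14],
     [2,6,9,10,13], [1,5,8,15,16], [3,4,7,10,11], [8,9,12,13,14],
     [2,5,6,11,15], [1,4,7,9,16], [3,8,10,11,13], [6,12,14,15,16]])"
  by code_simp

lemma ex_block:
  assumes "n \<ge> 8" "n \<noteq> 9"
  shows "\<exists>ws. is_block n ws"
  using assms
proof (induction n rule: less_induct)
  case (less n)
  show ?case
  proof (cases "n \<in> {8, 10, 11, 12, 13, 14, 15, 17}")
    case True
    then show ?thesis
      using block_8 block_10 block_11 block_12 block_13 block_14 block_15 block_17 by blast
  next
    case False
    then have "n - 8 < n" "n - 8 \<ge> 8" "n - 8 \<noteq> 9" using less.prems by auto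
    then obtain ws where "is_block (n - 8) ws" using less.IH by blast
    from is_block_append[OF block_8 this] show ?thesis using less.prems by auto
  qed
qed

lemma ex_tone_coloring_cycle_16:
  assumes "n \<ge> 8" "n \<noteq> 9"
  shows "\<exists>f. tone_coloring 5 16 (with_proj (cycle_graph n)) f"
proof -
  obtain ws where "is_block n ws" using ex_block[OF assms] by blast
  then show ?thesis
    using tone_coloring_closed_word[of 5 16 5 ws n] assms by (auto simp: is_block_def)
qed

section \<open>Colorings for the exceptional lengths\<close>

lemma ex_tone_coloring_cycle_3: "\<exists>f. tone_coloring 5 15 (with_proj (cycle_graph 3)) f"
proof -
  let ?ws = "[[1,2,3,4,5], [6,7,8,9,10], [11,12,13,14,15]]"
  have "tone_word 5 15 1 (?ws @ take 1 ?ws)" by code_simp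
  from tone_coloring_closed_word[OF this, of 3] show ?thesis by auto
qed

lemma ex_tone_coloring_cycle_4: "\<exists>f. tone_coloring 5 18 (with_proj (cycle_graph 4)) f"
proof -
  let ?ws = "[[1,2,3,4,5], [6,7,8,9,10], [5,11,12,13,14], [10,15,16,17,18]]"
  have "tone_word 5 18 2 (?ws @ take 2 ?ws)" by code_simp
  from tone_coloring_closed_word[OF this, of 4] show ?thesis by auto
qed

lemma ex_tone_coloring_cycle_5: "\<exists>f. tone_coloring 5 20 (with_proj (cycle_graph 5)) f"
proof -
  let ?ws = "[[1,2,3,4,5], [6,7,8,9,10], [4,11,12,13,14], [5,9,15,16,17],
             [10,14,18,19,20]]"
  have "tone_word 5 20 2 (?ws @ take 2 ?ws)" by code_simp
  from tone_coloring_closed_word[OF this, of 5] show ?thesis by auto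
qed

lemma ex_tone_coloring_cycle_6: "\<exists>f. tone_coloring 5 18 (with_proj (cycle_graph 6)) f"
proof -
  let ?ws = "[[1,2,3,4,5], [6,7,8,9,10], [2,11,12,13,14], [3,4,7,15,16],
             [5,8,9,12,17], [10,13,14,16,18]]"
  have "tone_word 5 18 3 (?ws @ take 3 ?ws)" by code_simp
  from tone_coloring_closed_word[OF this, of 6] show ?thesis by auto
qed

lemma ex_tone_coloring_cycle_7: "\<exists>f. tone_coloring 5 17 (with_proj (cycle_graph 7)) f"
proof -
  let ?ws = "[[1,2,3,4,5], [6,7,8,9,10], [11,12,13,14,15], [1,2,6,16,17],
             [3,4,7,8,12], [5,6,9,13,14], [10,12,15,16,17]]"
  have "tone_word 5 17 3 (?ws @ take 3 ?ws)" by code_simp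
  from tone_coloring_closed_word[OF this, of 7] show ?thesis by auto
qed

lemma ex_tone_coloring_cycle_9: "\<exists>f. tone_coloring 5 17 (with_proj (cycle_graph 9)) f"
proof -
  let ?ws = "[[1,2,3,4,5], [6,7,8,9,10], [1,11,12,13,14], [2,3,6,15,16],
             [4,7,8,11,17], [1,5,9,12,15], [2,4,6,10,13], [3,8,9,11,14],
             [6,12,15,16,17]]"
  have "tone_word 5 17 4 (?ws @ take 4 ?ws)" by code_simp
  from tone_coloring_closed_word[OF this, of 9] show ?thesis by auto
qed

section \<open>The 5-tone chromatic number of cycles\<close>

lemma tone_chromatic_number_eqI:
  assumes "0 < k" "\<exists>f. tone_coloring t k G f"
    and "\<And>j f. tone_coloring t j G f \<Longrightarrow> k \<le> j"
  shows "tone_chromatic_number t G = k"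
  unfolding tone_chromatic_number_def using assms by (intro Least_equality) auto

theorem theorem4p4:
  fixes n :: nat
  assumes "n \<ge> 3"
  shows "tone_chromatic_number 5 (with_proj (cycle_graph n)) =
    (if n = 5 then 20
     else if n \<in> {4, 6} then 18
     else if n \<in> {7, 9} then 17
     else if n = 3 then 15
     else 16)"
proof -
  consider "n = 3" | "n = 4" | "n = 5" | "n = 6" | "n = 7" | "n = 9" | "n \<ge> 8" "n \<noteq> 9"
    using assms by linarith
  then show ?thesis
  proof cases
    case 1
    have "tone_chromatic_number 5 (with_proj (cycle_graph 3)) = 15"
      by (rule tone_chromatic_number_eqI[OF _ ex_tone_coloring_cycle_3 tone_coloring_cycle_3_ge]) simp_all
    then show ?thesis using 1 by simp
  next
    case 2
    have "tone_chromatic_number 5 (with_proj (cycle_graph 4)) = 18"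
      by (rule tone_chromatic_number_eqI[OF _ ex_tone_coloring_cycle_4 tone_coloring_cycle_4_ge]) simp_all
    then show ?thesis using 2 by simp
  next
    case 3
    have "tone_chromatic_number 5 (with_proj (cycle_graph 5)) = 20"
      by (rule tone_chromatic_number_eqI[OF _ ex_tone_coloring_cycle_5 tone_coloring_cycle_5_ge]) simp_all
    then show ?thesis using 3 by simp
  next
    case 4
    have "tone_chromatic_number 5 (with_proj (cycle_graph 6)) = 18"
      by (rule tone_chromatic_number_eqI[OF _ ex_tone_coloring_cycle_6 tone_coloring_cycle_6_ge]) simp_all
    then show ?thesis using 4 by simp
  next
    case 5
    have "tone_chromatic_number 5 (with_proj (cycle_graph 7)) = 17"
      by (rule tone_chromatic_number_eqI[OF _ ex_tone_coloring_cycle_7 tone_coloring_cycle_7_ge]) simp_all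
    then show ?thesis using 5 by simp
  next
    case 6
    have "tone_chromatic_number 5 (with_proj (cycle_graph 9)) = 17"
      by (rule tone_chromatic_number_eqI[OF _ ex_tone_coloring_cycle_9 tone_coloring_cycle_9_ge]) simp_all
    then show ?thesis using 6 by simp
  next
    case 7
    have "16 \<le> j" if "tone_coloring 5 j (with_proj (cycle_graph n)) f" for j f
      using four_consecutive_labels[OF that] 7 by simp
    then have "tone_chromatic_number 5 (with_proj (cycle_graph n)) = 16"
      by (intro tone_chromatic_number_eqI ex_tone_coloring_cycle_16[OF 7]) simp_all
    then show ?thesis using 7 by auto
  qed
qed

end
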